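(* Let $n\ge 3$, let $P_n(R)$ be a regular $n$-gon in the Euclidean plane with vertices $A_1,\dots,A_n$ and circumradius $R>0$, and let $M$ be an arbitrary point of the plane. Then for every $m=2,\dots,n-1$, $$S_n^{(2m)}=\left(S_n^{(2)}\right)^m+\sum_{k=1}^{\lfloor m/2\rfloor}\binom{m}{2k}\binom{2k}{k}R^{2k}\left(S_n^{(2)}-R^2\right)^k\left(S_n^{(2)}\right)^{m-2k}.$$
   Context: The cyclic averages are $S_n^{(2m)}=\frac1n\sum_{i=1}^n d_i^{2m}$ with $d_i=|MA_i|$, for $1\le m\le n-1$. *)

theory Defs
  imports "HOL-Analysis.Analysis"
begin

text \<open>
  A polygon with \<open>n\<close> vertices is a family \<open>A 1, \<dots>, A n\<close> listed in cyclic order; the values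
  of \<open>A\<close> outside \<open>{1..n}\<close> are irrelevant.
\<close>

definition next_vertex :: "nat \<Rightarrow> nat \<Rightarrow> nat" where
  "next_vertex n i = (if i = n then 1 else i + 1)"

definition vertex_angle :: "'a::euclidean_space \<Rightarrow> 'a \<Rightarrow> 'a \<Rightarrow> real" where
  "vertex_angle P Q S = arccos (inner (P - Q) (S - Q) / (norm (P - Q) * norm (S - Q)))"

text \<open>
  Strict convexity: for every side, some line contains it and has all the remaining vertices
  strictly on one side. For \<open>n \<ge> 3\<close> this forces \<open>u \<noteq> 0\<close> and the vertices to be distinct,
  and it excludes star polygons.
\<close>

definition convex_polygon :: "nat \<Rightarrow> (nat \<Rightarrow> real^2) \<Rightarrow> bool" where
  "convex_polygon n A \<longleftrightarrow>
     (\<forall>i\<in>{1..n}. \<exists>u b. inner u (A i) = b \<and> inner u (A (next_vertex n i)) = b \<and>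
        (\<forall>j\<in>{1..n} - {i, next_vertex n i}. inner u (A j) < b))"

definition equilateral_polygon :: "nat \<Rightarrow> (nat \<Rightarrow> real^2) \<Rightarrow> bool" where
  "equilateral_polygon n A \<longleftrightarrow>
     (\<exists>s. \<forall>i\<in>{1..n}. dist (A i) (A (next_vertex n i)) = s)"

definition equiangular_polygon :: "nat \<Rightarrow> (nat \<Rightarrow> real^2) \<Rightarrow> bool" where
  "equiangular_polygon n A \<longleftrightarrow>
     (\<exists>t. \<forall>i\<in>{1..n}.
        vertex_angle (A i) (A (next_vertex n i)) (A (next_vertex n (next_vertex n i))) = t)"

definition regular_polygon :: "nat \<Rightarrow> (nat \<Rightarrow> real^2) \<Rightarrow> bool" where
  "regular_polygon n A \<longleftrightarrow>
     convex_polygon n A \<and> equilateral_polygon n A \<and> equiangular_polygon n A"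

definition has_circumradius :: "nat \<Rightarrow> (nat \<Rightarrow> real^2) \<Rightarrow> real \<Rightarrow> bool" where
  "has_circumradius n A R \<longleftrightarrow> (\<exists>c. \<forall>i\<in>{1..n}. dist c (A i) = R)"

text \<open>The superscript in \<open>S\<^sub>n\<^sup>(\<^sup>p\<^sup>)\<close> is the exponent \<open>p\<close> of the distances.\<close>

definition cyclic_average :: "nat \<Rightarrow> (nat \<Rightarrow> real^2) \<Rightarrow> real^2 \<Rightarrow> nat \<Rightarrow> real" where
  "cyclic_average n A M p = (1 / real n) * (\<Sum>i=1..n. dist M (A i) ^ p)"

end

theory Submission
  imports Defs
begin

text \<open>
  Place the circumcentre at the origin of the complex plane and let \<open>z\<^sub>i\<close> be the vertices.
  Equal chords make every ratio \<open>z\<^sub>i\<^sub>+\<^sub>1 / z\<^sub>i\<close> equal to \<open>w\<close> or its conjugate, and distinctness of the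
  vertices forbids a switch between the two. Hence \<open>z\<^sub>i\<^sub>+\<^sub>1 = w z\<^sub>i\<close> throughout, and the power sums
  \<open>\<Sum> z\<^sub>i\<^sup>k\<close> vanish for \<open>0 < k < n\<close>. Writing \<open>p\<close> for the point \<open>M\<close>, we have
  \<open>d\<^sub>i\<^sup>2 = |p|\<^sup>2 + R\<^sup>2 - 2 Re (p\<^sup>* z\<^sub>i)\<close>, where \<open>p\<^sup>*\<close> is the conjugate. In the binomial expansion of
  its \<open>m\<close>-th power, only the terms with equally many factors \<open>p\<^sup>* z\<^sub>i\<close> and conjugates
  survive the average, and these give the central binomial coefficients.
\<close>

section \<open>Successor map on the vertices, and their distinctness\<close>

lemma bij_betw_next_vertex:
  "bij_betw (next_vertex n) {1..n} {1..n}"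
proof -
  have "inj_on (next_vertex n) {1..n}"
    by (auto simp: inj_on_def next_vertex_def split: if_splits)
  moreover have "next_vertex n ` {1..n} \<subseteq> {1..n}"
    by (auto simp: next_vertex_def)
  ultimately show ?thesis
    by (simp add: bij_betw_def endo_inj_surj)
qed

lemma next_vertex_in:
  "i \<in> {1..n} \<Longrightarrow> next_vertex n i \<in> {1..n}"
  by (auto simp: next_vertex_def)

lemma next_next_vertex_neq:
  "\<lbrakk>n \<ge> 3; i \<in> {1..n}\<rbrakk> \<Longrightarrow> next_vertex n (next_vertex n i) \<noteq> i"
  by (auto simp: next_vertex_def split: if_splits)

text \<open>A vertex that coincides with \<open>A k\<close> lies on the line supporting the side at
  \<open>k\<close>, so strictness leaves only the index \<open>next_vertex n k\<close> for it.
  Applied in both directions, two coinciding vertices would be each other's successors, impossible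
  for at least three vertices.\<close>

lemma convex_polygon_inj_on:
  assumes "n \<ge> 3" "convex_polygon n A"
  shows "inj_on A {1..n}"
proof (rule inj_onI, rule ccontr)
  fix i j assume ij: "i \<in> {1..n}" "j \<in> {1..n}" "A i = A j" "i \<noteq> j"
  have off_side: "l = next_vertex n k"
    if k: "k \<in> {1..n}" and l: "l \<in> {1..n}" and eq: "A k = A l" and neq: "k \<noteq> l" for k l
  proof (rule ccontr)
    assume "l \<noteq> next_vertex n k"
    then have l': "l \<in> {1..n} - {k, next_vertex n k}"
      using l neq by simp
    obtain u b where "inner u (A k) = b"
      and below: "\<forall>j\<in>{1..n} - {k, next_vertex n k}. inner u (A j) < b"
      using bspec[OF assms(2)[unfolded convex_polygon_def] k] by (elim exE conjE)
    moreover have "inner u (A l) < b"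
      using below l' by (rule bspec)
    ultimately show False
      using eq by simp
  qed
  have "j = next_vertex n i"
    using off_side[OF ij] .
  moreover have "i = next_vertex n j"
    using off_side[OF ij(2,1) ij(3)[symmetric] ij(4)[symmetric]] .
  ultimately show False
    using next_next_vertex_neq[OF assms(1) ij(1)] by metis
qed

section \<open>From equal chords to a rotation and vanishing power sums\<close>

lemma norm_eq_Re_eq_cases:
  fixes x y :: complex
  assumes "norm x = norm y" "Re x = Re y"
  shows "x = y \<or> x = cnj y"
proof -
  have "(Im x)\<^sup>2 = (Im y)\<^sup>2"
    using assms by (metis add_left_cancel cmod_power2)
  then show ?thesis
    using assms(2) by (auto simp: complex_eq_iff power2_eq_iff)
qed

text \<open>Law of cosines: \<open>v / u\<close> lies on the unit circle, and its real part is the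
  cosine of the central angle, which the chord length determines.\<close>

lemma Re_divide_of_norm_eq:
  fixes u v :: complex
  assumes "norm u = R" "norm v = R" "R > 0"
  shows "Re (v / u) = 1 - (norm (v - u))\<^sup>2 / (2 * R\<^sup>2)"
proof -
  have u: "(Re u)\<^sup>2 + (Im u)\<^sup>2 = R\<^sup>2" and v: "(Re v)\<^sup>2 + (Im v)\<^sup>2 = R\<^sup>2"
    using assms by (metis cmod_power2)+
  have "Re (v / u) = (Re v * Re u + Im v * Im u) / R\<^sup>2"
    using u by (simp add: Re_divide)
  moreover have "(norm (v - u))\<^sup>2 = 2 * R\<^sup>2 - 2 * (Re v * Re u + Im v * Im u)"
    using u v unfolding cmod_power2 by (simp add: power2_eq_square algebra_simps)
  ultimately show ?thesis
    using assms(3) by (simp add: field_simps)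
qed

lemma equilateral_cocyclic_rotation:
  fixes z :: "nat \<Rightarrow> complex"
  assumes n: "n \<ge> 3" and inj: "inj_on z {1..n}" and R: "R > 0"
    and norm: "\<And>i. i \<in> {1..n} \<Longrightarrow> norm (z i) = R"
    and side: "\<And>i. i \<in> {1..n} \<Longrightarrow> norm (z (next_vertex n i) - z i) = s"
  shows "\<exists>w. \<forall>i\<in>{1..n}. z (next_vertex n i) = w * z i"
proof -
  define r where "r i = z (next_vertex n i) / z i" for i
  have nz: "z i \<noteq> 0" if "i \<in> {1..n}" for i
    using norm[OF that] R by auto
  have norm_r: "norm (r i) = 1" if "i \<in> {1..n}" for i
    using norm[OF that] norm[OF next_vertex_in[OF that]] R by (simp add: r_def norm_divide)
  have Re_r: "Re (r i) = 1 - s\<^sup>2 / (2 * R\<^sup>2)" if "i \<in> {1..n}" for i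
    unfolding r_def using Re_divide_of_norm_eq[OF norm[OF that] norm[OF next_vertex_in[OF that]] R]
    by (simp add: side[OF that])
  have step: "r (next_vertex n i) = r i" if i: "i \<in> {1..n}" for i
  proof (rule ccontr)
    let ?j = "next_vertex n i"
    have j: "?j \<in> {1..n}" using i by (rule next_vertex_in)
    assume "r ?j \<noteq> r i"
    \<comment> \<open>For unit modulus, conjugate means inverse, so a switch would undo the previous
      step and return to \<open>z i\<close> after two steps.\<close>
    then have "r ?j = cnj (r i)"
      using norm_eq_Re_eq_cases[of "r ?j" "r i"] norm_r Re_r i j by auto
    then have "r ?j * r i = 1"
      using norm_r[OF i] complex_norm_square[of "r i"] by (simp add: mult.commute)
    then have "z (next_vertex n ?j) = z i"
      using nz[OF i] nz[OF j] by (simp add: r_def)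
    then have "next_vertex n ?j = i"
      using inj i next_vertex_in[OF j] by (simp add: inj_on_eq_iff)
    then show False
      using next_next_vertex_neq[OF n i] by simp
  qed
  \<comment> \<open>The induction moves only between successive indices up to \<open>n\<close>;
    since \<open>r n\<close> is included, the closing side from \<open>A n\<close> to
    \<open>A 1\<close> has the same ratio.\<close>
  have r_const: "Suc i \<le> n \<longrightarrow> r (Suc i) = r 1" for i
  proof (induction i)
    case (Suc i)
    then show ?case
      using step[of "Suc i"] by (auto simp: next_vertex_def)
  qed simp
  have "z (next_vertex n i) = r 1 * z i" if "i \<in> {1..n}" for i
  proof -
    have "r i = r 1"
      using r_const[of "i - 1"] that by simp
    moreover have "z (next_vertex n i) = r i * z i"
      using nz[OF that] by (simp add: r_def)
    ultimately show ?thesis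
      by simp
  qed
  then show ?thesis
    by blast
qed

text \<open>A cyclic shift of the index preserves the sum but multiplies it by \<open>w ^ k\<close>.
  This factor is not 1, since otherwise the vertices with indices 1 and \<open>Suc k\<close> would
  coincide.\<close>

lemma power_sum_eq_0:
  fixes z :: "nat \<Rightarrow> complex"
  assumes inj: "inj_on z {1..n}"
    and rot: "\<And>i. i \<in> {1..n} \<Longrightarrow> z (next_vertex n i) = w * z i"
    and k: "0 < k" "k < n"
  shows "(\<Sum>i=1..n. z i ^ k) = 0"
proof -
  have pow: "Suc i \<le> n \<longrightarrow> z (Suc i) = w ^ i * z 1" for i
  proof (induction i)
    case (Suc i)
    then show ?case
      using rot[of "Suc i"] by (auto simp: next_vertex_def mult.assoc)
  qed simp
  have "w ^ k \<noteq> 1"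
  proof
    assume "w ^ k = 1"
    then have "z (Suc k) = z 1"
      using pow[of k] k by simp
    then show False
      using inj k by (auto dest: inj_onD)
  qed
  moreover have "(\<Sum>i=1..n. z i ^ k) = w ^ k * (\<Sum>i=1..n. z i ^ k)"
  proof -
    have "(\<Sum>i=1..n. z i ^ k) = (\<Sum>i=1..n. z (next_vertex n i) ^ k)"
      by (rule sum.reindex_bij_betw[OF bij_betw_next_vertex, symmetric])
    also have "\<dots> = w ^ k * (\<Sum>i=1..n. z i ^ k)"
      by (simp add: rot power_mult_distrib sum_distrib_left)
    finally show ?thesis .
  qed
  ultimately show ?thesis
    by simp
qed

section \<open>Mixed moments of points on a circle\<close>

text \<open>Each pair of a factor \<open>z i\<close> and its conjugate contributes
  \<open>R ^ 2\<close>. The unpaired factors form a pure power of exponent at most \<open>m\<close>,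
  whose sum vanishes unless the exponent is 0.\<close>

lemma sum_power_mult_cnj_power:
  fixes z :: "'i \<Rightarrow> complex"
  assumes norm: "\<And>i. i \<in> I \<Longrightarrow> norm (z i) = R"
    and vanish: "\<And>k. \<lbrakk>0 < k; k \<le> m\<rbrakk> \<Longrightarrow> (\<Sum>i\<in>I. z i ^ k) = 0"
    and "a \<le> m" "b \<le> m"
  shows "(\<Sum>i\<in>I. z i ^ a * cnj (z i) ^ b) =
           (if a = b then of_nat (card I) * of_real R ^ (2 * a) else 0)"
proof -
  have zz: "z i * cnj (z i) = of_real R ^ 2" if "i \<in> I" for i
    using complex_norm_square[of "z i"] norm[OF that] by simp
  have main: "(\<Sum>i\<in>I. z i ^ (b + d) * cnj (z i) ^ b) = of_real R ^ (2 * b) * (\<Sum>i\<in>I. z i ^ d)"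
    for b d
  proof -
    have "z i ^ (b + d) * cnj (z i) ^ b = of_real R ^ (2 * b) * z i ^ d" if "i \<in> I" for i
    proof -
      have "z i ^ (b + d) * cnj (z i) ^ b = (z i * cnj (z i)) ^ b * z i ^ d"
        by (simp add: power_add power_mult_distrib)
      then show ?thesis
        by (simp add: zz[OF that] power_mult)
    qed
    then show ?thesis
      by (simp add: sum_distrib_left)
  qed
  consider "a = b" | d where "d > 0" "a = b + d" | d where "d > 0" "b = a + d"
    by (metis less_imp_add_positive linorder_neqE_nat)
  then show ?thesis
  proof cases
    case 1
    then show ?thesis using main[of b 0] by simp
  next
    case (2 d)
    then show ?thesis using main[of b d] vanish[of d] assms(3) by simp
  next
    \<comment> \<open>Surplus conjugates: conjugating the whole sum exchanges the two
      exponents.\<close>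
    case (3 d)
    have "(\<Sum>i\<in>I. z i ^ a * cnj (z i) ^ b) = cnj (\<Sum>i\<in>I. z i ^ (a + d) * cnj (z i) ^ a)"
      using 3 by (simp add: mult.commute)
    then show ?thesis using 3 main[of a d] vanish[of d] assms(4) by simp
  qed
qed

lemma sum_double_Re_power:
  fixes z :: "'i \<Rightarrow> complex"
  assumes norm: "\<And>i. i \<in> I \<Longrightarrow> norm (z i) = R"
    and vanish: "\<And>k. \<lbrakk>0 < k; k \<le> m\<rbrakk> \<Longrightarrow> (\<Sum>i\<in>I. z i ^ k) = 0"
    and l: "l \<le> m"
  shows "(\<Sum>i\<in>I. (2 * Re (q * z i)) ^ l) =
           (if even l
            then real (card I) * real (l choose (l div 2)) * norm q ^ l * R ^ l else 0)"
proof -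
  have "of_real (\<Sum>i\<in>I. (2 * Re (q * z i)) ^ l) =
      (\<Sum>i\<in>I. (q * z i + cnj (q * z i)) ^ l)"
    by (simp only: complex_add_cnj of_real_sum of_real_power)
  also have "\<dots> = (\<Sum>i\<in>I. \<Sum>r\<le>l. of_nat (l choose r) * q ^ r * cnj q ^ (l - r) *
      (z i ^ r * cnj (z i) ^ (l - r)))"
    by (simp add: binomial_ring power_mult_distrib mult_ac)
  also have "\<dots> = (\<Sum>r\<le>l. of_nat (l choose r) * q ^ r * cnj q ^ (l - r) *
      (\<Sum>i\<in>I. z i ^ r * cnj (z i) ^ (l - r)))"
    by (subst sum.swap) (simp add: sum_distrib_left)
  also have "\<dots> = (\<Sum>r\<le>l. of_nat (l choose r) * q ^ r * cnj q ^ (l - r) *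
      (if r = l - r then of_nat (card I) * of_real R ^ (2 * r) else 0))"
    using l by (intro sum.cong refl arg_cong2[where f = "(*)"] sum_power_mult_cnj_power[OF norm vanish])
      auto
  \<comment> \<open>For even \<open>l\<close> only the middle index survives; the condition is put
    as an equation for \<open>r\<close> so that the sum collapses to that single term.\<close>
  also have "\<dots> = (\<Sum>r\<le>l. if r = l div 2 \<and> even l then
      of_nat (l choose r) * (q * cnj q) ^ r * of_nat (card I) * of_real R ^ l else 0)"
  proof (intro sum.cong refl)
    fix r assume "r \<in> {..l}"
    then have "r = l - r \<longleftrightarrow> l = 2 * r"
      by auto
    moreover have "r = l div 2 \<and> even l \<longleftrightarrow> l = 2 * r"
      by auto
    ultimately show "of_nat (l choose r) * q ^ r * cnj q ^ (l - r) *
        (if r = l - r then of_nat (card I) * of_real R ^ (2 * r) else 0) =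
      (if r = l div 2 \<and> even l then
        of_nat (l choose r) * (q * cnj q) ^ r * of_nat (card I) * of_real R ^ l else 0)"
      by (cases "l = 2 * r") (simp_all only: if_True if_False, simp_all add: power_mult_distrib)
  qed
  also have "\<dots> = (if even l then
      of_nat (l choose (l div 2)) * (q * cnj q) ^ (l div 2) * of_nat (card I) * of_real R ^ l else 0)"
    by (cases "even l") (simp_all add: sum.delta)
  also have "\<dots> = of_real (if even l
            then real (card I) * real (l choose (l div 2)) * norm q ^ l * R ^ l else 0)"
    by (auto simp: complex_norm_square[symmetric] simp flip: power_mult)
  finally show ?thesis
    by (simp only: of_real_eq_iff)
qed

section \<open>Sums of even powers of distances\<close>

lemma sum_even_index:
  fixes f :: "nat \<Rightarrow> 'b::comm_monoid_add"
  shows "(\<Sum>l\<le>m. if even l then f l else 0) = f 0 + (\<Sum>k=1..m div 2. f (2 * k))"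
proof -
  have "(\<Sum>l\<le>m. if even l then f l else 0) = (\<Sum>l | l \<in> {..m} \<and> even l. f l)"
    by (rule sum.inter_filter[symmetric]) simp
  also have "\<dots> = (\<Sum>k\<le>m div 2. f (2 * k))"
    by (rule sum.reindex_bij_witness[of _ "\<lambda>k. 2 * k" "\<lambda>l. l div 2"]) auto
  also have "\<dots> = f 0 + (\<Sum>k=1..m div 2. f (2 * k))"
    by (simp add: atMost_atLeast0 sum.atLeast_Suc_atMost)
  finally show ?thesis .
qed

lemma sum_dist_even_power:
  fixes z :: "'i \<Rightarrow> complex" and p :: complex
  assumes norm: "\<And>i. i \<in> I \<Longrightarrow> norm (z i) = R"
    and vanish: "\<And>k. \<lbrakk>0 < k; k \<le> m\<rbrakk> \<Longrightarrow> (\<Sum>i\<in>I. z i ^ k) = 0"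
  defines "S \<equiv> (norm p)\<^sup>2 + R\<^sup>2"
  shows "(\<Sum>i\<in>I. norm (p - z i) ^ (2 * m)) = real (card I) *
           (S ^ m + (\<Sum>k=1..m div 2. real (m choose (2 * k)) * real ((2 * k) choose k) * R ^ (2 * k) *
              (S - R\<^sup>2) ^ k * S ^ (m - 2 * k)))"
proof -
  define x where "x i = 2 * Re (cnj p * z i)" for i
  \<comment> \<open>For even \<open>l\<close> the sign \<open>(-1) ^ l\<close> is 1, and
    \<open>g l\<close> is then the \<open>l\<close>-th term of the expansion averaged over
    \<open>I\<close>.\<close>
  define g where "g l = real (m choose l) * real (l choose (l div 2)) * norm p ^ l * R ^ l * S ^ (m - l)"
    for l
  have d: "(norm (p - z i))\<^sup>2 = - x i + S" if "i \<in> I" for i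
  proof -
    have "(Re (z i))\<^sup>2 + (Im (z i))\<^sup>2 = R\<^sup>2"
      using norm[OF that] by (metis cmod_power2)
    then show ?thesis
      unfolding S_def x_def cmod_power2 by (simp add: power2_eq_square algebra_simps)
  qed
  have "(\<Sum>i\<in>I. norm (p - z i) ^ (2 * m)) = (\<Sum>i\<in>I. (- x i + S) ^ m)"
    by (simp add: power_mult d)
  also have "\<dots> = (\<Sum>i\<in>I. \<Sum>l\<le>m. real (m choose l) * (-1) ^ l * S ^ (m - l) * x i ^ l)"
    unfolding binomial_ring by (simp add: power_minus[of "x _"] mult_ac)
  also have "\<dots> = (\<Sum>l\<le>m. real (m choose l) * (-1) ^ l * S ^ (m - l) * (\<Sum>i\<in>I. x i ^ l))"
    by (subst sum.swap) (simp add: sum_distrib_left)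
  also have "\<dots> = (\<Sum>l\<le>m. if even l then real (card I) * g l else 0)"
  proof (intro sum.cong refl)
    fix l assume "l \<in> {..m}"
    then have "(\<Sum>i\<in>I. x i ^ l) = (if even l
        then real (card I) * real (l choose (l div 2)) * norm (cnj p) ^ l * R ^ l else 0)"
      unfolding x_def by (intro sum_double_Re_power[OF norm vanish]) auto
    then show "real (m choose l) * (-1) ^ l * S ^ (m - l) * (\<Sum>i\<in>I. x i ^ l) =
        (if even l then real (card I) * g l else 0)"
      by (simp add: g_def)
  qed
  also have "\<dots> = real (card I) * (g 0 + (\<Sum>k=1..m div 2. g (2 * k)))"
    by (simp add: sum_even_index distrib_left sum_distrib_left)
  also have "g 0 = S ^ m"
    by (simp add: g_def)
  \<comment> \<open>By the choice of \<open>S\<close>, the factor \<open>norm p ^ (2 * k)\<close> is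
    \<open>(S - R\<^sup>2) ^ k\<close>.\<close>
  also have "(\<Sum>k=1..m div 2. g (2 * k)) = (\<Sum>k=1..m div 2.
      real (m choose (2 * k)) * real ((2 * k) choose k) * R ^ (2 * k) * (S - R\<^sup>2) ^ k * S ^ (m - 2 * k))"
    by (simp add: g_def S_def mult_ac flip: power_mult)
  finally show ?thesis .
qed

section \<open>Transfer to the complex plane and conclusion\<close>

definition complex_of_vec2 :: "real^2 \<Rightarrow> complex" where
  "complex_of_vec2 v = Complex (v $ 1) (v $ 2)"

lemma norm_complex_of_vec2:
  "norm (complex_of_vec2 v) = norm v"
  by (simp add: complex_of_vec2_def norm_vec_def L2_set_def sum_2 cmod_def)

lemma complex_of_vec2_diff:
  "complex_of_vec2 (v - w) = complex_of_vec2 v - complex_of_vec2 w"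
  by (simp add: complex_of_vec2_def complex_eq_iff)

lemma complex_of_vec2_dist:
  "norm (complex_of_vec2 (v - c) - complex_of_vec2 (w - c)) = dist v w"
  by (simp add: dist_norm norm_complex_of_vec2 flip: complex_of_vec2_diff)

theorem theorem4p1:
  fixes n m :: nat and A :: "nat \<Rightarrow> real^2" and R :: real and M :: "real^2"
  assumes "n \<ge> 3"
    and "regular_polygon n A"
    and "R > 0"
    and "has_circumradius n A R"
    and "2 \<le> m" and "m \<le> n - 1"
  shows "cyclic_average n A M (2 * m) =
           (cyclic_average n A M 2) ^ m +
           (\<Sum>k=1..m div 2. real (m choose (2 * k)) * real ((2 * k) choose k) * R ^ (2 * k) *
              (cyclic_average n A M 2 - R\<^sup>2) ^ k * (cyclic_average n A M 2) ^ (m - 2 * k))"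
proof -
  obtain c where c: "\<And>i. i \<in> {1..n} \<Longrightarrow> dist c (A i) = R"
    using assms(4) unfolding has_circumradius_def by blast
  obtain s where s: "\<And>i. i \<in> {1..n} \<Longrightarrow> dist (A i) (A (next_vertex n i)) = s"
    using assms(2) unfolding regular_polygon_def equilateral_polygon_def by blast
  define z where "z i = complex_of_vec2 (A i - c)" for i
  define p where "p = complex_of_vec2 (M - c)"
  define S where "S = (norm p)\<^sup>2 + R\<^sup>2"
  have norm_z: "norm (z i) = R" if "i \<in> {1..n}" for i
    using c[OF that] by (simp add: z_def norm_complex_of_vec2 dist_norm norm_minus_commute)
  have side: "norm (z (next_vertex n i) - z i) = s" if "i \<in> {1..n}" for i
    using s[OF that] by (simp add: z_def complex_of_vec2_dist dist_commute)
  have "inj_on A {1..n}"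
    using assms(1,2) convex_polygon_inj_on unfolding regular_polygon_def by blast
  moreover have "z i = z j \<longleftrightarrow> A i = A j" for i j
    using complex_of_vec2_dist[of "A i" c "A j"] by (auto simp: z_def)
  ultimately have inj: "inj_on z {1..n}"
    unfolding inj_on_def by blast
  obtain w where rot: "\<And>i. i \<in> {1..n} \<Longrightarrow> z (next_vertex n i) = w * z i"
    using equilateral_cocyclic_rotation[OF assms(1) inj assms(3) norm_z side] by blast
  have vanish: "(\<Sum>i=1..n. z i ^ k) = 0" if "0 < k" "k < n" for k
    using power_sum_eq_0[where z = z and w = w, OF inj rot that] .
  \<comment> \<open>Stated for all \<open>j < n\<close> because it is used twice: at
    \<open>j = 1\<close> the sum over \<open>k\<close> is empty and \<open>S\<close> is identified
    as the mean squared distance; at \<open>j = m\<close> the claim follows. The bound on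
    \<open>j\<close> is the range in which the power sums vanish.\<close>
  have average: "cyclic_average n A M (2 * j) = S ^ j +
      (\<Sum>k=1..j div 2. real (j choose (2 * k)) * real ((2 * k) choose k) * R ^ (2 * k) *
        (S - R\<^sup>2) ^ k * S ^ (j - 2 * k))" if "j < n" for j
  proof -
    have "cyclic_average n A M (2 * j) = (1 / real n) * (\<Sum>i=1..n. norm (p - z i) ^ (2 * j))"
      by (simp add: cyclic_average_def p_def z_def complex_of_vec2_dist)
    also have "\<dots> = S ^ j +
      (\<Sum>k=1..j div 2. real (j choose (2 * k)) * real ((2 * k) choose k) * R ^ (2 * k) *
        (S - R\<^sup>2) ^ k * S ^ (j - 2 * k))"
      using that assms(1) unfolding S_def
      by (subst sum_dist_even_power[OF norm_z vanish]) auto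
    finally show ?thesis .
  qed
  have "cyclic_average n A M 2 = S"
    using average[of 1] assms(1) by simp
  then show ?thesis
    using average[of m] assms(1,6) by simp
qed

end
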